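(* Let $S$ be a measurable space, $P$ a probability measure on $S$, $n\geq 1$, and let $Z_1,\dots,Z_n$ be independent and identically distributed random variables with distribution $P$ on $S$. Let $\mathcal{F}$ be a countable class of measurable functions on $S$ such that $0\leq f(z)\leq 1$ for all $f\in \mathcal F$ and $z\in S$. Then, for all $t>0$ and $\gamma>0$ such that $t n \sqrt{\gamma} \geq 16 / 9$, $$ \mathbb P \left( \sup_{f\in \mathcal F} \frac{P_n(f) -P (f) -\gamma }{\sqrt{ P_n(f) }} > t \right) \leq \mathbb S_{\mathrm{sg} (\mathcal F)}(2n)\exp\left(-\frac{nt^2}{4}\right),$$ and $$ \mathbb P \left( \sup_{f\in \mathcal F} \frac{P(f) -P _n (f) -\gamma }{\sqrt{ P (f ) }} > t \right) \leq \mathbb S_{\mathrm{sg} (\mathcal F)}(2n)\exp\left(-\frac{nt^2}{4}\right).$$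
   Context: $P(f)=\int f\,\mathrm dP$ and $P_n(f)=n^{-1}\sum_{i=1}^n f(Z_i)$. The class of subgraphs of a class $\mathcal F$ of $[0,1]$-valued functions on $S$ is $$\mathrm{sg}(\mathcal F)=\{\{(x,y)\in S\times[0,1]\,:\, y\leq f(x)\}\,:\, f\in\mathcal F\},$$ a class of subsets of $S\times[0,1]$. The shatter coefficient of a class $\mathcal C$ of subsets of a set $T$ is, for any $m\geq 1$, $$\mathbb S_{\mathcal C}(m)=\max_{(w_1,\ldots,w_m)\in T^m}\left|\{(\mathbf 1_C(w_1),\ldots,\mathbf 1_C(w_m))\,:\, C\in\mathcal C\}\right|.$$ Convention: $0/0=0$, and a negative number divided by $0$ is $-\infty$. *)

theory Defs
  imports "HOL-Probability.Probability"
begin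

text \<open>A tuple of \<open>T\<^sup>m\<close> is a list of length \<open>m\<close> with entries in \<open>T\<close>.
  The maximum is over naturals bounded by \<open>2 ^ m\<close>, see \<open>finite_shatter_values\<close> below;
  it is attained whenever \<open>T\<close> is nonempty.\<close>

definition shatter_coeff :: "'a set \<Rightarrow> 'a set set \<Rightarrow> nat \<Rightarrow> nat" where
  "shatter_coeff T \<C> m =
     Max {card {map (indicator C :: 'a \<Rightarrow> nat) w | C. C \<in> \<C>} | w. length w = m \<and> set w \<subseteq> T}"

lemma finite_shatter_values:
  "finite {card {map (indicator C :: 'a \<Rightarrow> nat) w | C. C \<in> \<C>} | w. length w = m \<and> set w \<subseteq> T}"
proof (rule finite_subset)
  show "{card {map (indicator C :: 'a \<Rightarrow> nat) w | C. C \<in> \<C>} | w. length w = m \<and> set w \<subseteq> T} \<subseteq> {..2 ^ m}"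
  proof clarsimp
    fix w :: "'a list" assume m: "m = length w"
    have "{map (indicator C :: 'a \<Rightarrow> nat) w | C. C \<in> \<C>} \<subseteq> {xs. set xs \<subseteq> {0, 1} \<and> length xs = length w}"
      by (auto simp: indicator_def)
    then have "card {map (indicator C :: 'a \<Rightarrow> nat) w | C. C \<in> \<C>}
        \<le> card {xs. set xs \<subseteq> {0, 1::nat} \<and> length xs = length w}"
      by (intro card_mono finite_lists_length_eq) auto
    also have "\<dots> = 2 ^ length w"
      by (subst card_lists_length_eq) (auto simp: numeral_2_eq_2)
    finally show "card {map (indicator C :: 'a \<Rightarrow> nat) w | C. C \<in> \<C>} \<le> 2 ^ length w" .
  qed
qed simp

definition subgraphs :: "'s set \<Rightarrow> ('s \<Rightarrow> real) set \<Rightarrow> ('s \<times> real) set set" where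
  "subgraphs S \<F> = {{(x, y). x \<in> S \<and> y \<in> {0..1} \<and> y \<le> f x} | f. f \<in> \<F>}"

definition empirical_mean :: "(nat \<Rightarrow> 'w \<Rightarrow> 's) \<Rightarrow> nat \<Rightarrow> ('s \<Rightarrow> real) \<Rightarrow> 'w \<Rightarrow> real" where
  "empirical_mean Z n f \<omega> = (\<Sum>i=1..n. f (Z i \<omega>)) / real n"

text \<open>Ratios are formed in \<^typ>\<open>ereal\<close>, where \<open>0 / 0 = 0\<close> and a negative number divided by
  \<open>0\<close> is \<open>-\<infinity>\<close>; a supremum over an empty class is \<open>-\<infinity>\<close>.\<close>

lemma ereal_ratio_conventions:
  "ereal 0 / ereal 0 = 0" "x < 0 \<Longrightarrow> ereal x / ereal 0 = - \<infinity>"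
  by (auto simp: divide_ereal_def zero_ereal_def[symmetric])

end

theory Submission
  imports Defs "HOL-Probability.Hoeffding"
begin

text \<open>The proof is an exponential version of symmetrization with a ghost sample. Write \<open>a\<close> for
\<open>P\<^sub>n f\<close> and \<open>b\<close> for \<open>P f\<close>, and put
\<open>H(a, b) = exp (r (a - b) / sqrt (a + b + \<gamma>))\<close> with \<open>r = n t / sqrt 2\<close> for the first
inequality and \<open>r = - n t / sqrt 2\<close> for the second (this is \<open>ratio_exp\<close>).

On the event \<open>a - b - \<gamma> > t sqrt a\<close> the difference exceeds \<open>\<gamma>\<close>, so
\<open>a + b + \<gamma> \<le> 2 a\<close> and hence \<open>H(a, b) \<ge> exp (n t\<^sup>2 / 2)\<close>; exchanging \<open>a\<close> and \<open>b\<close> gives the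
same for the second inequality (\<open>ratio_le_of_gap\<close>). By Markov's inequality it is enough to show
that the expectation of \<open>sup\<^sub>f H(P\<^sub>n f, P f)\<close> is at most the shatter coefficient times
\<open>exp (n t\<^sup>2 / 4)\<close>. No multiplicative constant is lost, because the usual estimate of the
probability that the ghost sample behaves well is replaced by Jensen's inequality.

The key fact is that \<open>H\<close> is convex in each variable separately (\<open>convex_on_ratio_exp\<close>). The
exponent is convex in one variable and concave in the other, but the exponential compensates the
concavity as soon as \<open>\<bar>r\<bar> sqrt \<gamma>\<close> is large enough; this is where the lower bound on
\<open>t n sqrt \<gamma>\<close> enters, and why \<open>\<gamma>\<close> is put under the root. Convexity is used for two
replacements, both of which can only increase the expectation:
the mean \<open>P f\<close> by the average of \<open>f\<close> over an independent ghost sample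
(\<open>nn_integral_sup_ghost\<close>), and every value \<open>f z\<close> by the indicator of \<open>u \<le> f z\<close>,
where \<open>u\<close> is uniform on the unit interval and independent for each sample point
(\<open>ratio_exp_le_rounding\<close>).
The second replacement turns functions into subgraphs.

It remains to bound a supremum over zero-one patterns on \<open>2 n\<close> random points \<open>(z, u)\<close>. Their
law does not change when the two copies of an index are exchanged. Averaged over all such
exchanges, \<open>H\<close> of one fixed pattern is a product of hyperbolic cosines and at most
\<open>exp (n t\<^sup>2 / 4)\<close> (\<open>sum_flip_ratio_exp\<close>), and the number of patterns is at most the shatter
coefficient (\<open>card_below_le_shatter\<close>).\<close>

section \<open>Exponential moments of random signs\<close>

text \<open>Hoeffding's lemma for a fair coin with values \<open>- 1\<close> and \<open>1\<close>.\<close>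
lemma cosh_le_exp_half_square: "cosh (x::real) \<le> exp (x\<^sup>2 / 2)"
proof -
  have *: "cosh y \<le> exp (y\<^sup>2 / 2)" if "y \<ge> 0" for y :: real
  proof -
    have "- y + ln (1 + (1/2) * (exp (2 * y) - 1)) \<le> y\<^sup>2 / 2"
      using Hoeffdings_lemma_aux[of "2 * y" "1/2"] that by (simp add: power2_eq_square)
    then have "exp (- y) * exp (ln (1 + (1/2) * (exp (2 * y) - 1))) \<le> exp (y\<^sup>2 / 2)"
      by (simp flip: exp_add)
    moreover have "exp (- y) * exp (ln (1 + (1/2) * (exp (2 * y) - 1))) = cosh y"
      using that by (subst exp_ln)
        (auto simp: cosh_def algebra_simps add_nonneg_pos simp flip: exp_add)
    ultimately show ?thesis by simp
  qed
  show ?thesis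
    using *[of "\<bar>x\<bar>"] by simp
qed

text \<open>The subset \<open>\<sigma>\<close> records the indices that receive the sign minus. Expanding the product of the
sums \<open>exp (- c i) + exp (c i)\<close> shows that the left-hand side is a product of hyperbolic cosines.\<close>
lemma sum_signs_exp:
  fixes c :: "'a \<Rightarrow> real"
  assumes "finite I"
  shows "(\<Sum>\<sigma>\<in>Pow I. exp (\<Sum>i\<in>I. (if i \<in> \<sigma> then - c i else c i)))
    \<le> 2 ^ card I * exp (\<Sum>i\<in>I. (c i)\<^sup>2 / 2)"
proof -
  have "(\<Sum>\<sigma>\<in>Pow I. exp (\<Sum>i\<in>I. (if i \<in> \<sigma> then - c i else c i)))
      = (\<Sum>\<sigma>\<in>Pow I. (\<Prod>i\<in>\<sigma>. exp (- c i)) * (\<Prod>i\<in>I - \<sigma>. exp (c i)))"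
  proof (rule sum.cong)
    fix \<sigma> assume \<sigma>: "\<sigma> \<in> Pow I"
    have "(\<Sum>i\<in>I. (if i \<in> \<sigma> then - c i else c i)) = (\<Sum>i\<in>\<sigma>. - c i) + (\<Sum>i\<in>I - \<sigma>. c i)"
      using \<sigma> assms by (subst sum.If_cases) (auto simp: Int_absorb1 Diff_eq intro!: arg_cong2[of _ _ _ _ minus] sum.cong)
    then show "exp (\<Sum>i\<in>I. (if i \<in> \<sigma> then - c i else c i))
        = (\<Prod>i\<in>\<sigma>. exp (- c i)) * (\<Prod>i\<in>I - \<sigma>. exp (c i))"
      using \<sigma> assms by (simp only: exp_add) (auto simp: exp_sum finite_subset)
  qed simp
  also have "\<dots> = (\<Prod>i\<in>I. exp (- c i) + exp (c i))"
    using assms by (simp add: prod_add)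
  also have "\<dots> = (\<Prod>i\<in>I. 2 * cosh (c i))"
    by (intro prod.cong) (simp_all add: cosh_field_def)
  also have "\<dots> \<le> (\<Prod>i\<in>I. 2 * exp ((c i)\<^sup>2 / 2))"
    by (intro prod_mono) (auto simp: cosh_le_exp_half_square)
  also have "\<dots> = 2 ^ card I * exp (\<Sum>i\<in>I. (c i)\<^sup>2 / 2)"
    using assms by (simp add: prod.distrib exp_sum)
  finally show ?thesis .
qed

section \<open>Separate convexity of the exponential ratio\<close>

text \<open>Write \<open>s = x + k\<close>, and let \<open>q\<close> be the derivative of \<open>sqrt s - \<kappa> / sqrt s\<close>. The second
derivative of the exponential has the sign of \<open>e\<^sup>2 q\<^sup>2 + e q'\<close>. In terms of
\<open>\<beta> = \<kappa> / (2 s)\<close> one has \<open>q = (1/2 + \<beta>) / sqrt s\<close> and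
\<open>\<bar>q'\<bar> = (1/4 + 3 \<beta> / 2) / (s sqrt s)\<close>. The optimal comparison
\<open>1/4 + 3 \<beta> / 2 \<le> 9/8 (1/2 + \<beta>)\<^sup>2\<close>, an equality at \<open>\<beta> = 1/6\<close>, explains the
constant \<open>9/8\<close>.\<close>
lemma convex_on_exp_sqrt_diff:
  fixes e k \<kappa> l :: real
  assumes "0 < l + k" "0 \<le> \<kappa>" "9 / 8 \<le> \<bar>e\<bar> * sqrt (l + k)"
  shows "convex_on {l<..} (\<lambda>x. exp (e * (sqrt (x + k) - \<kappa> / sqrt (x + k))))"
proof -
  define v where "v x = sqrt (x + k)" for x
  define w where "w x = inverse (v x)" for x
  define q where "q x = w x / 2 + \<kappa> / 2 * w x ^ 3" for x
  define q' where "q' x = - (w x ^ 3 / 4) - 3 / 4 * \<kappa> * w x ^ 5" for x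
  define h where "h x = exp (e * (v x - \<kappa> * w x))" for x
  have dv: "(v has_real_derivative w x / 2) (at x)" if "x > l" for x
    unfolding v_def[abs_def] w_def
    using that assms(1) by (auto intro!: derivative_eq_intros)
  have dw: "(w has_real_derivative - (w x ^ 3) / 2) (at x)" if "x > l" for x
    unfolding w_def[abs_def]
    by (rule DERIV_cong, rule DERIV_inverse_fun[OF dv[OF that]])
      (use that assms(1) in \<open>auto simp: v_def w_def power3_eq_cube simp flip: inverse_mult_distrib\<close>)
  have dh: "(h has_real_derivative h x * (e * q x)) (at x)" if "x > l" for x
    unfolding h_def[abs_def] q_def
    by (auto intro!: derivative_eq_intros dv[OF that] dw[OF that] simp: algebra_simps)
  have dq: "(q has_real_derivative q' x) (at x)" if "x > l" for x
    unfolding q_def[abs_def] q'_def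
    by (auto intro!: derivative_eq_intros dw[OF that] simp: algebra_simps eval_nat_numeral)
  have ddh: "((\<lambda>x. h x * (e * q x)) has_real_derivative h x * (e\<^sup>2 * (q x)\<^sup>2 + e * q' x)) (at x)"
    if "x > l" for x
    by (rule DERIV_cong, rule DERIV_mult[OF dh[OF that] DERIV_cmult[OF dq[OF that]]])
      (auto simp: algebra_simps power2_eq_square)
  \<comment> \<open>Only the absolute value of \<open>e\<close> matters, so that both variables of the ratio are covered.\<close>
  have nonneg: "0 \<le> e\<^sup>2 * (q x)\<^sup>2 + e * q' x" if x: "x > l" for x
  proof -
    define \<beta> where "\<beta> = \<kappa> * (w x)\<^sup>2 / 2"
    have w: "w x > 0" and \<beta>: "\<beta> \<ge> 0" using x assms by (auto simp: v_def w_def \<beta>_def)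
    have q: "q x = w x * (1/2 + \<beta>)" "q' x = - (w x ^ 3 * (1/4 + 3/2 * \<beta>))"
      by (auto simp: q_def q'_def \<beta>_def algebra_simps eval_nat_numeral)
    have "9 / 8 \<le> \<bar>e\<bar> * sqrt (x + k)"
      by (rule order_trans[OF assms(3)]) (use x in \<open>auto intro!: mult_left_mono\<close>)
    then have e: "9 / 8 * w x \<le> \<bar>e\<bar>"
      using x assms(1) by (simp add: v_def w_def field_simps)
    have "1/4 + 3/2 * \<beta> \<le> 9 / 8 * (1/2 + \<beta>)\<^sup>2"
      using zero_le_power2[of "1 - 6 * \<beta>"] by (simp add: power2_eq_square field_simps)
    then have "w x ^ 3 * (1/4 + 3/2 * \<beta>) \<le> w x ^ 3 * (9 / 8 * (1/2 + \<beta>)\<^sup>2)"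
      using w by (intro mult_left_mono) auto
    also have "\<dots> = (9 / 8 * w x) * (q x)\<^sup>2"
      by (simp add: q power2_eq_square eval_nat_numeral)
    also have "\<dots> \<le> \<bar>e\<bar> * (q x)\<^sup>2"
      using e by (intro mult_right_mono) auto
    finally have "\<bar>q' x\<bar> \<le> \<bar>e\<bar> * (q x)\<^sup>2"
      using w \<beta> by (simp add: q)
    then have "\<bar>e\<bar> * \<bar>q' x\<bar> \<le> \<bar>e\<bar> * (\<bar>e\<bar> * (q x)\<^sup>2)"
      by (intro mult_left_mono) auto
    then have "\<bar>e * q' x\<bar> \<le> e\<^sup>2 * (q x)\<^sup>2"
      by (simp add: abs_mult power2_eq_square flip: mult.assoc)
    then show ?thesis by linarith
  qed
  have "convex_on {l<..} h"
    by (rule f''_ge0_imp_convex[OF _ dh ddh]) (auto simp: nonneg h_def)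
  then show ?thesis
    by (simp add: h_def[abs_def] v_def w_def divide_inverse)
qed

lemma convex_on_eq:
  assumes "convex_on A f" and eq: "\<And>x. x \<in> A \<Longrightarrow> f x = g x"
  shows "convex_on A g"
proof (rule convex_onI)
  show "convex A" by (rule convex_on_imp_convex[OF assms(1)])
  fix s :: real and x y assume s: "0 < s" "s < 1" and "x \<in> A" "y \<in> A"
  moreover have "(1 - s) *\<^sub>R x + s *\<^sub>R y \<in> A"
    using convexD_alt[OF \<open>convex A\<close>, of x y s] s \<open>x \<in> A\<close> \<open>y \<in> A\<close> by simp
  ultimately show "g ((1 - s) *\<^sub>R x + s *\<^sub>R y) \<le> (1 - s) * g x + s * g y"
    using convex_onD[OF assms(1), of s x y] by (simp add: eq)
qed

definition ratio_exp :: "real \<Rightarrow> real \<Rightarrow> real \<Rightarrow> real \<Rightarrow> real" where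
  "ratio_exp r \<gamma> a b = exp (r * (a - b) / sqrt (a + b + \<gamma>))"

lemma ratio_exp_commute: "ratio_exp r \<gamma> a b = ratio_exp (- r) \<gamma> b a"
  by (simp add: ratio_exp_def algebra_simps)

text \<open>With \<open>s = a + b + \<gamma>\<close> the exponent is a multiple of \<open>sqrt s - (2 b + \<gamma>) / sqrt s\<close>. The
interval starts a little below \<open>0\<close> because Jensen's inequality is applied on an open interval that
contains all averages, including \<open>0\<close>; there \<open>s\<close> is still at least \<open>9/10 \<gamma>\<close>. By
\<open>ratio_exp_commute\<close> and the absolute value on \<open>r\<close> the same holds in the second variable.\<close>
lemma convex_on_ratio_exp:
  assumes "\<gamma> > 0" "b \<ge> 0" "9 / 8 \<le> \<bar>r\<bar> * sqrt (9 / 10 * \<gamma>)"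
  shows "convex_on {- \<gamma> / 10<..} (\<lambda>a. ratio_exp r \<gamma> a b)"
proof -
  have *: "9 / 10 * \<gamma> \<le> - \<gamma> / 10 + (b + \<gamma>)"
    using assms by simp
  have "9 / 8 \<le> \<bar>r\<bar> * sqrt (- \<gamma> / 10 + (b + \<gamma>))"
    by (rule order_trans[OF assms(3)]) (intro mult_left_mono real_sqrt_le_mono *, simp)
  then have "convex_on {- \<gamma> / 10<..}
      (\<lambda>a. exp (r * (sqrt (a + (b + \<gamma>)) - (2 * b + \<gamma>) / sqrt (a + (b + \<gamma>)))))"
    using assms by (intro convex_on_exp_sqrt_diff) auto
  moreover have "exp (r * (sqrt (a + (b + \<gamma>)) - (2 * b + \<gamma>) / sqrt (a + (b + \<gamma>))))
      = ratio_exp r \<gamma> a b" if "a > - \<gamma> / 10" for a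
  proof -
    have pos: "a + (b + \<gamma>) > 0" using that assms by simp
    then have "sqrt (a + (b + \<gamma>)) - (2 * b + \<gamma>) / sqrt (a + (b + \<gamma>))
        = (a - b) / sqrt (a + (b + \<gamma>))"
      by (simp add: field_simps)
    then show ?thesis by (simp add: ratio_exp_def add.assoc)
  qed
  ultimately show ?thesis
    by (rule convex_on_eq) auto
qed

section \<open>Jensen's inequality for averages\<close>

text \<open>Convexity also supplies integrability: on the unit interval the nonnegative function \<open>q\<close> stays
below \<open>q 0 + q 1\<close>.\<close>
lemma (in prob_space) jensen_unit_interval:
  fixes q :: "real \<Rightarrow> real"
  assumes X [measurable]: "random_variable borel X" and X01: "\<And>\<omega>. \<omega> \<in> space M \<Longrightarrow> X \<omega> \<in> {0..1}"
    and q: "convex_on {l<..} q" "l < 0" "\<And>x. 0 \<le> q x" and [measurable]: "q \<in> borel_measurable borel"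
  shows "ennreal (q (expectation X)) \<le> (\<integral>\<^sup>+\<omega>. ennreal (q (X \<omega>)) \<partial>M)"
proof -
  have bd: "q x \<le> q 0 + q 1" if "x \<in> {0..1}" for x
  proof -
    have "q ((1 - x) *\<^sub>R 0 + x *\<^sub>R 1) \<le> (1 - x) * q 0 + x * q 1"
      using that q(2) by (intro convex_onD[OF q(1)]) auto
    also have "\<dots> \<le> 1 * q 0 + 1 * q 1"
      using that q(3) by (intro add_mono mult_right_mono) auto
    finally show ?thesis by simp
  qed
  have iq: "integrable M (\<lambda>\<omega>. q (X \<omega>))"
    using X01 bd q(3) by (intro integrable_const_bound[where B = "q 0 + q 1"]) auto
  have "integrable M X"
    using X01 by (intro integrable_const_bound[where B = 1]) auto
  then have "q (expectation X) \<le> expectation (\<lambda>\<omega>. q (X \<omega>))"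
    by (rule jensens_inequality[where I = "{l<..}"]) (use X01 q(2) iq q(1) in fastforce)+
  then show ?thesis
    by (subst nn_integral_eq_integral) (auto simp: iq q(3) ennreal_leI)
qed

text \<open>The index \<open>(i, b)\<close> stands for the \<open>i\<close>-th point of the sample if \<open>b\<close> is true and of the ghost
sample if it is false.\<close>
definition avg :: "nat \<Rightarrow> bool \<Rightarrow> (nat \<times> bool \<Rightarrow> real) \<Rightarrow> real" where
  "avg n b x = (\<Sum>i=1..n. x (i, b)) / real n"

definition flip :: "nat set \<Rightarrow> nat \<times> bool \<Rightarrow> nat \<times> bool" where
  "flip \<sigma> = (\<lambda>(i, b). (i, b \<noteq> (i \<in> \<sigma>)))"

text \<open>The zero-one pattern that the subgraph of \<open>f\<close> cuts out of the points \<open>(z j, u j)\<close>.\<close>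
definition below :: "('s \<Rightarrow> real) \<Rightarrow> ('j \<Rightarrow> 's) \<Rightarrow> ('j \<Rightarrow> real) \<Rightarrow> 'j \<Rightarrow> real" where
  "below f z u j = of_bool (u j \<le> f (z j))"

text \<open>Restricting the space, and not only the mass, to the unit interval keeps every outcome among the
points over which the shatter coefficient takes its maximum.\<close>
definition unit_uniform :: "real measure" where
  "unit_uniform = restrict_space lborel {0..1}"

abbreviation double_index :: "nat \<Rightarrow> (nat \<times> bool) set" where
  "double_index n \<equiv> {1..n} \<times> UNIV"

abbreviation block :: "nat \<Rightarrow> bool \<Rightarrow> (nat \<times> bool) set" where
  "block n b \<equiv> {1..n} \<times> {b}"

lemma double_index_split: "double_index n = block n True \<union> block n False"
  by auto

lemma avg_cong: "(\<And>j. j \<in> block n b \<Longrightarrow> x j = y j) \<Longrightarrow> avg n b x = avg n b y"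
  by (simp add: avg_def)

lemma avg_in_01:
  assumes "\<And>j. j \<in> block n b \<Longrightarrow> x j \<in> {0..1}"
  shows "avg n b x \<in> {0..1}"
proof -
  have "(\<Sum>i=1..n. x (i, b)) \<le> (\<Sum>i=1..n. 1)"
    using assms by (intro sum_mono) auto
  moreover have "0 \<le> (\<Sum>i=1..n. x (i, b))"
    using assms by (intro sum_nonneg) auto
  ultimately show ?thesis
    by (cases "n = 0") (auto simp: avg_def divide_le_eq_1)
qed

lemma space_unit_uniform: "space unit_uniform = {0..1}"
  by (simp add: unit_uniform_def space_restrict_space)

lemma prob_space_unit_uniform: "prob_space unit_uniform"
  by (intro prob_spaceI)
    (simp add: unit_uniform_def space_restrict_space emeasure_restrict_space)

lemma borel_measurable_unit_uniform: "(\<lambda>u. u) \<in> borel_measurable unit_uniform"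
  unfolding unit_uniform_def by (intro measurable_restrict_space1) simp

lemma integral_unit_uniform_below:
  assumes "x \<in> {0..1}"
  shows "(\<integral>u. of_bool (u \<le> x) \<partial>unit_uniform) = x"
proof -
  have "(\<integral>u. of_bool (u \<le> x) \<partial>unit_uniform) = (\<integral>u. indicator {0..1} u *\<^sub>R (of_bool (u \<le> x) :: real) \<partial>lborel)"
    unfolding unit_uniform_def by (intro integral_restrict_space) simp
  also have "\<dots> = (\<integral>u. (indicator {0..x} u :: real) \<partial>lborel)"
    by (intro Bochner_Integration.integral_cong refl) (use assms in \<open>auto simp: indicator_def\<close>)
  also have "\<dots> = x" using assms by simp
  finally show ?thesis .
qed

lemma borel_measurable_ratio_exp [measurable (raw)]:
  assumes [measurable]: "f \<in> borel_measurable M" "g \<in> borel_measurable M"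
  shows "(\<lambda>x. ratio_exp r \<gamma> (f x) (g x)) \<in> borel_measurable M"
proof -
  have "(\<lambda>x. sqrt (f x + g x + \<gamma>)) \<in> borel_measurable M"
    by (rule measurable_compose[OF _ borel_measurable_sqrt]) measurable
  then show ?thesis
    unfolding ratio_exp_def by measurable
qed

lemma ratio_exp_nonneg: "0 \<le> ratio_exp r \<gamma> a b"
  by (simp add: ratio_exp_def)

lemma jensen_avg:
  fixes K :: "'k measure" and q :: "real \<Rightarrow> real"
  assumes K: "prob_space K" 
    and g [measurable]: "\<And>j. j \<in> block n b \<Longrightarrow> g j \<in> borel_measurable K"
    and g01: "\<And>j x. j \<in> block n b \<Longrightarrow> x \<in> space K \<Longrightarrow> g j x \<in> {0..1}"
    and q: "convex_on {l<..} q" "l < 0" "\<And>x. 0 \<le> q x" and [measurable]: "q \<in> borel_measurable borel"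
  shows "ennreal (q (avg n b (\<lambda>j. \<integral>x. g j x \<partial>K)))
    \<le> (\<integral>\<^sup>+x. ennreal (q (avg n b (\<lambda>j. g j (x j)))) \<partial>PiM (block n b) (\<lambda>_. K))"
proof -
  let ?N = "PiM (block n b) (\<lambda>_. K)"
  interpret N: prob_space ?N by (intro prob_space_PiM K)
  have meas: "(\<lambda>x. g j (x j)) \<in> borel_measurable ?N" if "j \<in> block n b" for j
    by (rule measurable_compose[OF measurable_component_singleton[OF that] g[OF that]])
  have component: "(\<integral>x. g j (x j) \<partial>?N) = (\<integral>x. g j x \<partial>K)" if "j \<in> block n b" for j
  proof -
    have "(\<integral>x. g j x \<partial>K) = (\<integral>x. g j x \<partial>distr ?N K (\<lambda>x. x j))"
      using distr_PiM_component[of "block n b" "\<lambda>_. K" j] that K by simp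
    also have "\<dots> = (\<integral>x. g j (x j) \<partial>?N)"
      using that by (intro integral_distr) auto
    finally show ?thesis ..
  qed
  have int: "integrable ?N (\<lambda>x. g j (x j))" if "j \<in> block n b" for j
    using g01[OF that] meas[OF that] that
    by (intro N.integrable_const_bound[where B = 1]) (auto simp: space_PiM PiE_def Pi_def)
  have "avg n b (\<lambda>j. \<integral>x. g j x \<partial>K) = (\<Sum>i=1..n. \<integral>x. g (i, b) (x (i, b)) \<partial>?N) / real n"
    unfolding avg_def by (intro arg_cong2[of _ _ _ _ divide] sum.cong refl component[symmetric]) simp
  also have "\<dots> = (\<integral>x. avg n b (\<lambda>j. g j (x j)) \<partial>?N)"
    unfolding avg_def integral_divide_zero
    by (intro arg_cong2[of _ _ _ _ divide] refl Bochner_Integration.integral_sum[symmetric] int) auto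
  finally have expectation: "avg n b (\<lambda>j. \<integral>x. g j x \<partial>K) = (\<integral>x. avg n b (\<lambda>j. g j (x j)) \<partial>?N)" .
  show ?thesis
    unfolding expectation
  proof (rule N.jensen_unit_interval)
    show "(\<lambda>x. avg n b (\<lambda>j. g j (x j))) \<in> borel_measurable ?N"
      unfolding avg_def by (intro borel_measurable_divide borel_measurable_sum meas) auto
    show "avg n b (\<lambda>j. g j (x j)) \<in> {0..1}" if "x \<in> space ?N" for x
      using that g01 by (intro avg_in_01) (auto simp: space_PiM PiE_def Pi_def)
  qed (use q in auto)
qed

lemma ratio_exp_le_nn_integral_avg:
  fixes K :: "'k measure"
  assumes K: "prob_space K"
    and g: "\<And>j. j \<in> block n c \<Longrightarrow> g j \<in> borel_measurable K"
    and g01: "\<And>j x. j \<in> block n c \<Longrightarrow> x \<in> space K \<Longrightarrow> g j x \<in> {0..1}"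
    and r: "\<gamma> > 0" "9 / 8 \<le> \<bar>r\<bar> * sqrt (9 / 10 * \<gamma>)" and b: "b \<ge> 0"
  shows "ennreal (ratio_exp r \<gamma> (avg n c (\<lambda>j. \<integral>x. g j x \<partial>K)) b)
      \<le> (\<integral>\<^sup>+x. ennreal (ratio_exp r \<gamma> (avg n c (\<lambda>j. g j (x j))) b) \<partial>PiM (block n c) (\<lambda>_. K))"
    and "ennreal (ratio_exp r \<gamma> b (avg n c (\<lambda>j. \<integral>x. g j x \<partial>K)))
      \<le> (\<integral>\<^sup>+x. ennreal (ratio_exp r \<gamma> b (avg n c (\<lambda>j. g j (x j)))) \<partial>PiM (block n c) (\<lambda>_. K))"
proof -
  have left: "ennreal (ratio_exp r' \<gamma> (avg n c (\<lambda>j. \<integral>x. g j x \<partial>K)) b)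
      \<le> (\<integral>\<^sup>+x. ennreal (ratio_exp r' \<gamma> (avg n c (\<lambda>j. g j (x j))) b) \<partial>PiM (block n c) (\<lambda>_. K))"
    if "\<bar>r'\<bar> = \<bar>r\<bar>" for r'
  proof (rule jensen_avg[OF K g g01, where q = "\<lambda>a. ratio_exp r' \<gamma> a b" and l = "- \<gamma> / 10"])
    show "convex_on {- \<gamma> / 10<..} (\<lambda>a. ratio_exp r' \<gamma> a b)"
      using r b that by (intro convex_on_ratio_exp) simp_all
  qed (use r in \<open>simp_all add: ratio_exp_nonneg\<close>)
  show "ennreal (ratio_exp r \<gamma> (avg n c (\<lambda>j. \<integral>x. g j x \<partial>K)) b)
      \<le> (\<integral>\<^sup>+x. ennreal (ratio_exp r \<gamma> (avg n c (\<lambda>j. g j (x j))) b) \<partial>PiM (block n c) (\<lambda>_. K))"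
    by (rule left) simp
  show "ennreal (ratio_exp r \<gamma> b (avg n c (\<lambda>j. \<integral>x. g j x \<partial>K)))
      \<le> (\<integral>\<^sup>+x. ennreal (ratio_exp r \<gamma> b (avg n c (\<lambda>j. g j (x j)))) \<partial>PiM (block n c) (\<lambda>_. K))"
    unfolding ratio_exp_commute[of r \<gamma> b] by (rule left) simp
qed

section \<open>Symmetrization over zero-one patterns\<close>

text \<open>Exchanges leave \<open>s\<close>, the sum of the two averages, unchanged and only flip the signs of the
differences \<open>d i = x (i, True) - x (i, False)\<close>. So the exponent is a signed sum with coefficients
\<open>c i = r d i / (n sqrt (s + \<gamma>))\<close>. Since the entries lie in the unit interval,
\<open>(d i)\<^sup>2 \<le> x (i, True) + x (i, False)\<close>, and the squares of the \<open>d i\<close> add up to at most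
\<open>n s\<close>: the normalization by the root makes the bound uniform in \<open>x\<close>.\<close>
lemma sum_flip_ratio_exp:
  assumes x: "\<And>j. j \<in> double_index n \<Longrightarrow> x j \<in> {0..1}" and "\<gamma> > 0" "n \<ge> 1"
  shows "(\<Sum>\<sigma>\<in>Pow {1..n}. ratio_exp r \<gamma> (avg n True (x \<circ> flip \<sigma>)) (avg n False (x \<circ> flip \<sigma>)))
    \<le> 2 ^ n * exp (r\<^sup>2 / (2 * real n))"
proof -
  define s where "s = avg n True x + avg n False x"
  define R where "R = sqrt (s + \<gamma>)"
  define c where "c i = r * (x (i, True) - x (i, False)) / (real n * R)" for i
  have s: "s \<ge> 0" using avg_in_01[of n _ x] x by (auto simp: s_def intro!: add_nonneg_nonneg)
  have R: "R > 0" "R\<^sup>2 = s + \<gamma>" using s assms by (auto simp: R_def)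
  have "ratio_exp r \<gamma> (avg n True (x \<circ> flip \<sigma>)) (avg n False (x \<circ> flip \<sigma>))
      = exp (\<Sum>i=1..n. (if i \<in> \<sigma> then - c i else c i))" for \<sigma>
  proof -
    have "avg n True (x \<circ> flip \<sigma>) + avg n False (x \<circ> flip \<sigma>) = s"
      unfolding avg_def s_def add_divide_distrib[symmetric] sum.distrib[symmetric]
      by (intro arg_cong2[of _ _ _ _ divide] sum.cong refl) (case_tac "xa \<in> \<sigma>"; simp add: flip_def add.commute)
    moreover have "r * (avg n True (x \<circ> flip \<sigma>) - avg n False (x \<circ> flip \<sigma>)) / R
        = (\<Sum>i=1..n. (if i \<in> \<sigma> then - c i else c i))"
      unfolding avg_def diff_divide_distrib[symmetric] sum_subtractf[symmetric]
        times_divide_eq_right sum_distrib_left sum_divide_distrib divide_divide_eq_left c_def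
      by (intro sum.cong) (auto simp: flip_def minus_divide_left algebra_simps)
    ultimately show ?thesis
      by (simp add: ratio_exp_def R_def)
  qed
  then have "(\<Sum>\<sigma>\<in>Pow {1..n}. ratio_exp r \<gamma> (avg n True (x \<circ> flip \<sigma>)) (avg n False (x \<circ> flip \<sigma>)))
      \<le> 2 ^ n * exp (\<Sum>i=1..n. (c i)\<^sup>2 / 2)"
    using sum_signs_exp[of "{1..n}" c] by simp
  also have "(\<Sum>i=1..n. (c i)\<^sup>2 / 2) \<le> r\<^sup>2 / (2 * real n)"
  proof -
    have "(\<Sum>i=1..n. (c i)\<^sup>2 / 2) = r\<^sup>2 / (2 * (real n)\<^sup>2 * (s + \<gamma>)) * (\<Sum>i=1..n. (x (i, True) - x (i, False))\<^sup>2)"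
      unfolding c_def sum_distrib_left
      by (intro sum.cong refl) (simp add: power_divide power_mult_distrib R(2) mult.assoc)
    also have "(\<Sum>i=1..n. (x (i, True) - x (i, False))\<^sup>2) \<le> (\<Sum>i=1..n. x (i, True) + x (i, False))"
    proof (rule sum_mono)
      fix i assume i: "i \<in> {1..n}"
      have "\<bar>x (i, True) - x (i, False)\<bar> \<le> 1" "\<bar>x (i, True) - x (i, False)\<bar> \<le> x (i, True) + x (i, False)"
        using x[of "(i, True)"] x[of "(i, False)"] i by auto
      then have "\<bar>x (i, True) - x (i, False)\<bar> * \<bar>x (i, True) - x (i, False)\<bar>
          \<le> 1 * (x (i, True) + x (i, False))"
        by (intro mult_mono) auto
      then show "(x (i, True) - x (i, False))\<^sup>2 \<le> x (i, True) + x (i, False)"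
        by (simp add: power2_eq_square)
    qed
    also have "(\<Sum>i=1..n. x (i, True) + x (i, False)) = real n * s"
      using assms by (simp add: s_def avg_def sum.distrib distrib_left)
    also have "r\<^sup>2 / (2 * (real n)\<^sup>2 * (s + \<gamma>)) * (real n * s) \<le> r\<^sup>2 / (2 * (real n)\<^sup>2 * (s + \<gamma>)) * (real n * (s + \<gamma>))"
      using s assms by (intro mult_left_mono) auto
    also have "\<dots> = r\<^sup>2 / (2 * real n)"
      using s assms by (simp add: power2_eq_square)
    finally show ?thesis using s assms by (simp add: divide_right_mono mult_left_mono)
  qed
  finally show ?thesis by simp
qed

text \<open>Listing \<open>J\<close> as a tuple turns distinct patterns into distinct indicator tuples of subgraphs.\<close>
lemma card_below_le_shatter:
  assumes J: "finite J" "card J = m" and z: "\<And>j. j \<in> J \<Longrightarrow> z j \<in> S" and u: "\<And>j. j \<in> J \<Longrightarrow> u j \<in> {0..1}"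
  shows "finite ((\<lambda>f. restrict (below f z u) J) ` \<F>)"
    and "card ((\<lambda>f. restrict (below f z u) J) ` \<F>) \<le> shatter_coeff (S \<times> {0..1}) (subgraphs S \<F>) m"
proof -
  let ?V = "(\<lambda>f. restrict (below f z u) J) ` \<F>"
  obtain js where js: "set js = J" "distinct js"
    using finite_distinct_list[OF J(1)] by blast
  define w where "w = map (\<lambda>j. (z j, u j)) js"
  define B where "B = {map (indicator C :: _ \<Rightarrow> nat) w | C. C \<in> subgraphs S \<F>}"
  have w: "length w = m" "set w \<subseteq> S \<times> {0..1}"
    using js J z u by (auto simp: w_def simp flip: distinct_card)
  have "B \<subseteq> {xs. set xs \<subseteq> {0, 1} \<and> length xs = m}"
    by (auto simp: B_def indicator_def w(1))
  then have finB: "finite B"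
    by (rule finite_subset) (intro finite_lists_length_eq, simp)
  define \<phi> where "\<phi> v = map (\<lambda>j. if v j = (1::real) then 1 else 0 :: nat) js" for v
  have inj: "inj_on \<phi> ?V"
  proof (rule inj_onI)
    fix v v' assume v: "v \<in> ?V" "v' \<in> ?V" and eq: "\<phi> v = \<phi> v'"
    then obtain f f' where f: "v = restrict (below f z u) J" "v' = restrict (below f' z u) J"
      by auto
    show "v = v'"
    proof
      fix j show "v j = v' j"
        using eq js f by (cases "j \<in> J") (auto simp: \<phi>_def below_def split: if_splits)
    qed
  qed
  have sub: "\<phi> ` ?V \<subseteq> B"
  proof clarsimp
    fix f assume f: "f \<in> \<F>"
    let ?C = "{(x, y). x \<in> S \<and> y \<in> {0..1} \<and> y \<le> f x}"
    have "\<phi> (restrict (below f z u) J) = map (indicator ?C) w"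
      using js z u by (auto simp: \<phi>_def w_def below_def indicator_def)
    then show "\<phi> (restrict (below f z u) J) \<in> B"
      using f unfolding B_def subgraphs_def by blast
  qed
  show "finite ?V" by (rule inj_on_finite[OF inj sub finB])
  have "card ?V \<le> card B" by (rule card_inj_on_le[OF inj sub finB])
  also have "\<dots> \<le> shatter_coeff (S \<times> {0..1}) (subgraphs S \<F>) m"
    unfolding shatter_coeff_def B_def using w by (intro Max_ge finite_shatter_values) auto
  finally show "card ?V \<le> shatter_coeff (S \<times> {0..1}) (subgraphs S \<F>) m" .
qed

definition sup_ratio_exp ::
  "real \<Rightarrow> real \<Rightarrow> nat \<Rightarrow> ('s \<Rightarrow> real) set \<Rightarrow> (nat \<times> bool \<Rightarrow> 's) \<Rightarrow> (nat \<times> bool \<Rightarrow> real) \<Rightarrow> ennreal" where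
  "sup_ratio_exp r \<gamma> n \<F> z u =
    (SUP f\<in>\<F>. ennreal (ratio_exp r \<gamma> (avg n True (below f z u)) (avg n False (below f z u))))"

lemma flip_double_index: "j \<in> double_index n \<Longrightarrow> flip \<sigma> j \<in> double_index n"
  by (auto simp: flip_def)

lemma inj_flip: "inj_on (flip \<sigma>) A"
  by (auto simp: inj_on_def flip_def)

text \<open>The supremum over \<open>f\<close> depends on \<open>f\<close> only through its pattern on the unexchanged points, so it is
at most the sum over the finitely many patterns, whose number does not depend on \<open>\<sigma>\<close>.\<close>
lemma sum_flip_sup_ratio_exp:
  assumes z: "\<And>j. j \<in> double_index n \<Longrightarrow> z j \<in> S"
    and u: "\<And>j. j \<in> double_index n \<Longrightarrow> u j \<in> {0..1}" and "\<gamma> > 0" "n \<ge> 1"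
  shows "(\<Sum>\<sigma>\<in>Pow {1..n}. sup_ratio_exp r \<gamma> n \<F>
        (\<lambda>j\<in>double_index n. z (flip \<sigma> j)) (\<lambda>j\<in>double_index n. u (flip \<sigma> j)))
    \<le> ennreal (2 ^ n * (real (shatter_coeff (S \<times> {0..1}) (subgraphs S \<F>) (2 * n))
        * exp (r\<^sup>2 / (2 * real n))))"
proof -
  let ?J = "double_index n"
  let ?S = "shatter_coeff (S \<times> {0..1}) (subgraphs S \<F>) (2 * n)"
  define V where "V = (\<lambda>f. restrict (below f z u) ?J) ` \<F>"
  define H where "H \<sigma> v = ratio_exp r \<gamma> (avg n True (v \<circ> flip \<sigma>)) (avg n False (v \<circ> flip \<sigma>))"
    for \<sigma> v
  have J: "finite ?J" "card ?J = 2 * n"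
    by (simp_all add: card_cartesian_product)
  have V: "finite V" "card V \<le> ?S"
    unfolding V_def using z u by (intro card_below_le_shatter J; blast)+
  have le: "sup_ratio_exp r \<gamma> n \<F> (\<lambda>j\<in>?J. z (flip \<sigma> j)) (\<lambda>j\<in>?J. u (flip \<sigma> j)) \<le> (\<Sum>v\<in>V. ennreal (H \<sigma> v))" for \<sigma>
    unfolding sup_ratio_exp_def
  proof (rule SUP_least)
    fix f assume f: "f \<in> \<F>"
    have "avg n b (below f (\<lambda>j\<in>?J. z (flip \<sigma> j)) (\<lambda>j\<in>?J. u (flip \<sigma> j)))
        = avg n b (restrict (below f z u) ?J \<circ> flip \<sigma>)" for b
      by (rule avg_cong) (auto simp: below_def flip_def)
    then have "ennreal (ratio_exp r \<gamma>
        (avg n True (below f (\<lambda>j\<in>?J. z (flip \<sigma> j)) (\<lambda>j\<in>?J. u (flip \<sigma> j))))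
        (avg n False (below f (\<lambda>j\<in>?J. z (flip \<sigma> j)) (\<lambda>j\<in>?J. u (flip \<sigma> j)))))
        = ennreal (H \<sigma> (restrict (below f z u) ?J))"
      by (simp add: H_def)
    also have "\<dots> \<le> (\<Sum>v\<in>V. ennreal (H \<sigma> v))"
      by (rule member_le_sum) (use V(1) f in \<open>auto simp only: V_def imageI\<close>, simp)
    finally show "ennreal (ratio_exp r \<gamma>
        (avg n True (below f (\<lambda>j\<in>?J. z (flip \<sigma> j)) (\<lambda>j\<in>?J. u (flip \<sigma> j))))
        (avg n False (below f (\<lambda>j\<in>?J. z (flip \<sigma> j)) (\<lambda>j\<in>?J. u (flip \<sigma> j)))))
        \<le> (\<Sum>v\<in>V. ennreal (H \<sigma> v))" .
  qed
  have "(\<Sum>\<sigma>\<in>Pow {1..n}. sup_ratio_exp r \<gamma> n \<F> (\<lambda>j\<in>?J. z (flip \<sigma> j)) (\<lambda>j\<in>?J. u (flip \<sigma> j)))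
      \<le> (\<Sum>\<sigma>\<in>Pow {1..n}. \<Sum>v\<in>V. ennreal (H \<sigma> v))"
    by (intro sum_mono le)
  also have "\<dots> = ennreal (\<Sum>v\<in>V. \<Sum>\<sigma>\<in>Pow {1..n}. H \<sigma> v)"
    by (subst sum.swap) (simp add: H_def ratio_exp_nonneg sum_nonneg)
  also have "\<dots> \<le> ennreal (\<Sum>v\<in>V. 2 ^ n * exp (r\<^sup>2 / (2 * real n)))"
  proof (intro ennreal_leI sum_mono)
    fix v assume "v \<in> V"
    then have "v j \<in> {0..1}" if "j \<in> ?J" for j
      using that by (auto simp: V_def below_def)
    then show "(\<Sum>\<sigma>\<in>Pow {1..n}. H \<sigma> v) \<le> 2 ^ n * exp (r\<^sup>2 / (2 * real n))"
      unfolding H_def using assms by (intro sum_flip_ratio_exp) auto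
  qed
  also have "\<dots> \<le> ennreal (2 ^ n * (real ?S * exp (r\<^sup>2 / (2 * real n))))"
    using V(2) by (intro ennreal_leI) (simp add: mult_right_mono)
  finally show ?thesis .
qed

lemma borel_measurable_sup_ratio_exp:
  assumes "countable \<F>" "\<And>f. f \<in> \<F> \<Longrightarrow> f \<in> borel_measurable P"
  shows "(\<lambda>(z, u). sup_ratio_exp r \<gamma> n \<F> z u) \<in> borel_measurable
    (PiM (double_index n) (\<lambda>_. P) \<Otimes>\<^sub>M PiM (double_index n) (\<lambda>_. unit_uniform))"
    (is "_ \<in> borel_measurable ?N")
proof -
  have below: "(\<lambda>w. below f (fst w) (snd w) j) \<in> borel_measurable ?N"
    if "f \<in> \<F>" "j \<in> double_index n" for f j
  proof -
    have [measurable]: "(\<lambda>w. snd w j) \<in> borel_measurable ?N"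
      by (intro measurable_compose[OF _ borel_measurable_unit_uniform]
          measurable_compose[OF measurable_snd measurable_component_singleton] that)
    have [measurable]: "(\<lambda>w. f (fst w j)) \<in> borel_measurable ?N"
      by (intro measurable_compose[OF _ assms(2)]
          measurable_compose[OF measurable_fst measurable_component_singleton] that)
    have "(\<lambda>w. below f (fst w) (snd w) j) = (\<lambda>w. if snd w j \<le> f (fst w j) then 1 else 0)"
      by (auto simp: below_def)
    also have "\<dots> \<in> borel_measurable ?N" by measurable
    finally show ?thesis .
  qed
  have "(\<lambda>w. avg n b (below f (fst w) (snd w))) \<in> borel_measurable ?N" if "f \<in> \<F>" for f b
    unfolding avg_def by (intro borel_measurable_divide borel_measurable_sum below that) auto
  then have "(\<lambda>w. sup_ratio_exp r \<gamma> n \<F> (fst w) (snd w)) \<in> borel_measurable ?N"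
    unfolding sup_ratio_exp_def
    by (intro borel_measurable_SUP assms(1) measurable_compose[OF _ measurable_ennreal] borel_measurable_ratio_exp)
  then show ?thesis by (simp add: case_prod_beta)
qed

text \<open>The law of the \<open>2 n\<close> points is invariant under every exchange \<open>\<sigma>\<close>, applied to \<open>z\<close> and \<open>u\<close>
together, so the integral equals its average over the \<open>2 ^ n\<close> exchanges, which
\<open>sum_flip_sup_ratio_exp\<close> bounds pointwise.\<close>
lemma nn_integral_sup_ratio_exp_le:
  assumes P: "prob_space P" and F: "countable \<F>" "\<And>f. f \<in> \<F> \<Longrightarrow> f \<in> borel_measurable P"
    and "\<gamma> > 0" "n \<ge> 1"
  shows "(\<integral>\<^sup>+z. \<integral>\<^sup>+u. sup_ratio_exp r \<gamma> n \<F> z u \<partial>PiM (double_index n) (\<lambda>_. unit_uniform)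
      \<partial>PiM (double_index n) (\<lambda>_. P))
    \<le> ennreal (real (shatter_coeff (space P \<times> {0..1}) (subgraphs (space P) \<F>) (2 * n))
        * exp (r\<^sup>2 / (2 * real n)))" (is "?I \<le> ennreal ?B")
proof -
  let ?J = "double_index n"
  let ?N = "PiM ?J (\<lambda>_. P)" and ?V = "PiM ?J (\<lambda>_. unit_uniform)"
  let ?\<Phi> = "sup_ratio_exp r \<gamma> n \<F>"
  interpret N: prob_space ?N by (intro prob_space_PiM P)
  interpret V: prob_space ?V by (intro prob_space_PiM prob_space_unit_uniform)
  define fz where "fz \<sigma> z = (\<lambda>j\<in>?J. z (flip \<sigma> j) :: 'a)" for \<sigma> z
  define fu where "fu \<sigma> u = (\<lambda>j\<in>?J. u (flip \<sigma> j) :: real)" for \<sigma> u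
  have fz [measurable]: "fz \<sigma> \<in> ?N \<rightarrow>\<^sub>M ?N" and dz: "distr ?N ?N (fz \<sigma>) = ?N" for \<sigma>
  proof -
    show "fz \<sigma> \<in> ?N \<rightarrow>\<^sub>M ?N" unfolding fz_def[abs_def]
      by (intro measurable_restrict measurable_component_singleton flip_double_index)
    show "distr ?N ?N (fz \<sigma>) = ?N" unfolding fz_def[abs_def]
      by (intro distr_PiM_reindex P inj_flip Pi_I flip_double_index)
  qed
  have fu [measurable]: "fu \<sigma> \<in> ?V \<rightarrow>\<^sub>M ?V" and du: "distr ?V ?V (fu \<sigma>) = ?V" for \<sigma>
  proof -
    show "fu \<sigma> \<in> ?V \<rightarrow>\<^sub>M ?V" unfolding fu_def[abs_def]
      by (intro measurable_restrict measurable_component_singleton flip_double_index)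
    show "distr ?V ?V (fu \<sigma>) = ?V" unfolding fu_def[abs_def]
      by (intro distr_PiM_reindex prob_space_unit_uniform inj_flip Pi_I flip_double_index)
  qed
  note [measurable] = borel_measurable_sup_ratio_exp[OF F, where r = r and \<gamma> = \<gamma> and n = n]
  have invariant: "?I = (\<integral>\<^sup>+z. \<integral>\<^sup>+u. ?\<Phi> (fz \<sigma> z) (fu \<sigma> u) \<partial>?V \<partial>?N)" for \<sigma>
  proof -
    have "?I = (\<integral>\<^sup>+z. \<integral>\<^sup>+u. ?\<Phi> z u \<partial>?V \<partial>distr ?N ?N (fz \<sigma>))"
      unfolding dz ..
    also have "\<dots> = (\<integral>\<^sup>+z. \<integral>\<^sup>+u. ?\<Phi> (fz \<sigma> z) u \<partial>?V \<partial>?N)"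
      by (subst nn_integral_distr) measurable
    also have "\<dots> = (\<integral>\<^sup>+z. \<integral>\<^sup>+u. ?\<Phi> (fz \<sigma> z) u \<partial>distr ?V ?V (fu \<sigma>) \<partial>?N)"
      unfolding du ..
    also have "\<dots> = (\<integral>\<^sup>+z. \<integral>\<^sup>+u. ?\<Phi> (fz \<sigma> z) (fu \<sigma> u) \<partial>?V \<partial>?N)"
      by (intro nn_integral_cong nn_integral_distr) measurable
    finally show ?thesis .
  qed
  have "ennreal (2 ^ n) * ?I = (\<Sum>\<sigma>\<in>Pow {1..n}. ?I)"
    by (simp add: card_Pow ennreal_power[symmetric])
  also have "\<dots> = (\<Sum>\<sigma>\<in>Pow {1..n}. \<integral>\<^sup>+z. \<integral>\<^sup>+u. ?\<Phi> (fz \<sigma> z) (fu \<sigma> u) \<partial>?V \<partial>?N)"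
    by (intro sum.cong refl invariant)
  also have "\<dots> = (\<integral>\<^sup>+z. (\<Sum>\<sigma>\<in>Pow {1..n}. \<integral>\<^sup>+u. ?\<Phi> (fz \<sigma> z) (fu \<sigma> u) \<partial>?V) \<partial>?N)"
    by (intro nn_integral_sum[symmetric]) measurable
  also have "\<dots> = (\<integral>\<^sup>+z. \<integral>\<^sup>+u. (\<Sum>\<sigma>\<in>Pow {1..n}. ?\<Phi> (fz \<sigma> z) (fu \<sigma> u)) \<partial>?V \<partial>?N)"
    by (intro nn_integral_cong nn_integral_sum[symmetric]) measurable
  also have "\<dots> \<le> (\<integral>\<^sup>+z. \<integral>\<^sup>+u. ennreal (2 ^ n * ?B) \<partial>?V \<partial>?N)"
  proof (intro nn_integral_mono)
    fix z u assume "z \<in> space ?N" "u \<in> space ?V"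
    then show "(\<Sum>\<sigma>\<in>Pow {1..n}. ?\<Phi> (fz \<sigma> z) (fu \<sigma> u)) \<le> ennreal (2 ^ n * ?B)"
      unfolding fz_def fu_def using assms
      by (intro sum_flip_sup_ratio_exp) (auto simp: space_PiM space_unit_uniform PiE_def Pi_def)
  qed
  also have "\<dots> = ennreal (2 ^ n) * ennreal ?B"
    by (simp only: nn_integral_const N.emeasure_space_1 V.emeasure_space_1 mult_1_right) (simp add: ennreal_mult)
  finally show ?thesis
    by (subst (asm) ennreal_mult_le_mult_iff) auto
qed

section \<open>Randomized rounding and the ghost sample\<close>


lemma nn_integral_fold_blocks:
  fixes K :: "'k measure"
  assumes "prob_space K" "g \<in> borel_measurable (PiM (double_index n) (\<lambda>_. K))"
  shows "(\<integral>\<^sup>+x. g x \<partial>PiM (double_index n) (\<lambda>_. K)) =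
    (\<integral>\<^sup>+x. \<integral>\<^sup>+y. g (merge (block n True) (block n False) (x, y))
      \<partial>PiM (block n False) (\<lambda>_. K) \<partial>PiM (block n True) (\<lambda>_. K))"
proof -
  interpret K: prob_space K by fact
  interpret product_sigma_finite "\<lambda>_::nat \<times> bool. K" by standard
  show ?thesis
    unfolding double_index_split
  proof (rule product_nn_integral_fold)
    show "g \<in> borel_measurable (PiM (block n True \<union> block n False) (\<lambda>_. K))"
      using assms(2) by (simp only: double_index_split)
  qed auto
qed

lemma avg_merge:
  "avg n True (\<lambda>j. g j (merge (block n True) (block n False) (x, y) j)) = avg n True (\<lambda>j. g j (x j))"
  "avg n False (\<lambda>j. g j (merge (block n True) (block n False) (x, y) j)) = avg n False (\<lambda>j. g j (y j))"
  by (auto intro!: avg_cong simp: merge_def)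

text \<open>Given \<open>x\<close>, the indicator of \<open>u \<le> x j\<close> for uniform \<open>u\<close> has mean \<open>x j\<close>. The two blocks are
rounded independently, one after the other, so convexity in each variable separately suffices.\<close>
lemma ratio_exp_le_rounding:
  assumes x: "\<And>j. j \<in> double_index n \<Longrightarrow> x j \<in> {0..1}"
    and r: "\<gamma> > 0" "9 / 8 \<le> \<bar>r\<bar> * sqrt (9 / 10 * \<gamma>)"
  shows "ennreal (ratio_exp r \<gamma> (avg n True x) (avg n False x))
    \<le> (\<integral>\<^sup>+u. ennreal (ratio_exp r \<gamma> (avg n True (\<lambda>j. of_bool (u j \<le> x j))) (avg n False (\<lambda>j. of_bool (u j \<le> x j))))
        \<partial>PiM (double_index n) (\<lambda>_. unit_uniform))"
proof -
  let ?a = "\<lambda>b u. avg n b (\<lambda>j. of_bool (u j \<le> x j))"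
  let ?VT = "PiM (block n True) (\<lambda>_. unit_uniform)" and ?VF = "PiM (block n False) (\<lambda>_. unit_uniform)"
  have g [measurable]: "(\<lambda>u. of_bool (u \<le> c) :: real) \<in> borel_measurable unit_uniform" for c
  proof -
    note [measurable] = borel_measurable_unit_uniform
    have "(\<lambda>u. of_bool (u \<le> c) :: real) = (\<lambda>u. if u \<le> c then 1 else 0)" by auto
    then show ?thesis by simp
  qed
  have gj: "(\<lambda>u. of_bool (u j \<le> c) :: real) \<in> borel_measurable (PiM (double_index n) (\<lambda>_. unit_uniform))"
    if "j \<in> double_index n" for j c
    by (rule measurable_compose[OF measurable_component_singleton[OF that]]) (rule g)
  have mean: "avg n b x = avg n b (\<lambda>j. \<integral>u. of_bool (u \<le> x j) \<partial>unit_uniform)" for b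
    by (intro avg_cong integral_unit_uniform_below[symmetric] x) auto
  have a: "?a b u \<in> {0..1}" for b u
    by (intro avg_in_01) auto
  have avgF: "avg n False x \<ge> 0"
    using avg_in_01[of n False x] x by auto
  have "ennreal (ratio_exp r \<gamma> (avg n True x) (avg n False x))
      \<le> (\<integral>\<^sup>+u. ennreal (ratio_exp r \<gamma> (?a True u) (avg n False x)) \<partial>?VT)"
    unfolding mean[of True]
    by (rule ratio_exp_le_nn_integral_avg(1)[OF prob_space_unit_uniform _ _ r avgF]) simp_all
  also have "\<dots> \<le> (\<integral>\<^sup>+u. \<integral>\<^sup>+u'. ennreal (ratio_exp r \<gamma> (?a True u) (?a False u')) \<partial>?VF \<partial>?VT)"
    unfolding mean[of False]
    by (intro nn_integral_mono ratio_exp_le_nn_integral_avg(2)[OF prob_space_unit_uniform _ _ r])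
      (use a[of True] in simp_all)
  also have "\<dots> = (\<integral>\<^sup>+u. ennreal (ratio_exp r \<gamma> (?a True u) (?a False u)) \<partial>PiM (double_index n) (\<lambda>_. unit_uniform))"
  proof (subst nn_integral_fold_blocks[OF prob_space_unit_uniform])
    show "(\<lambda>u. ennreal (ratio_exp r \<gamma> (?a True u) (?a False u))) \<in> borel_measurable (PiM (double_index n) (\<lambda>_. unit_uniform))"
      unfolding avg_def
      by (intro measurable_compose[OF _ measurable_ennreal] borel_measurable_ratio_exp
          borel_measurable_divide borel_measurable_sum gj) auto
  qed (simp only: avg_merge[of n "\<lambda>j y. of_bool (y \<le> x j)"])
  finally show ?thesis .
qed

text \<open>For a fixed sample, \<open>P f\<close> is the expected average over the ghost sample. The supremum over
\<open>f\<close> may then be moved inside the integral over the ghost sample, which only increases the value.\<close>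
lemma nn_integral_sup_ghost:
  assumes P: "prob_space P" and F: "countable \<F>" "\<And>f. f \<in> \<F> \<Longrightarrow> f \<in> borel_measurable P"
    and F01: "\<And>f z. f \<in> \<F> \<Longrightarrow> z \<in> space P \<Longrightarrow> f z \<in> {0..1}"
    and r: "\<gamma> > 0" "9 / 8 \<le> \<bar>r\<bar> * sqrt (9 / 10 * \<gamma>)" and n: "n \<ge> 1"
  shows "(\<integral>\<^sup>+z. (SUP f\<in>\<F>. ennreal (ratio_exp r \<gamma> (avg n True (\<lambda>j. f (z j))) (\<integral>x. f x \<partial>P)))
      \<partial>PiM (block n True) (\<lambda>_. P))
    \<le> (\<integral>\<^sup>+z. (SUP f\<in>\<F>. ennreal (ratio_exp r \<gamma> (avg n True (\<lambda>j. f (z j))) (avg n False (\<lambda>j. f (z j)))))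
      \<partial>PiM (double_index n) (\<lambda>_. P))"
proof -
  let ?NT = "PiM (block n True) (\<lambda>_. P)" and ?NF = "PiM (block n False) (\<lambda>_. P)"
  let ?a = "\<lambda>f b z. avg n b (\<lambda>j. f (z j))"
  have mean: "(\<integral>x. f x \<partial>P) = avg n False (\<lambda>j. \<integral>x. f x \<partial>P)" for f
    using n by (simp add: avg_def)
  have coordinate: "(\<lambda>z. f (z j)) \<in> borel_measurable (PiM (double_index n) (\<lambda>_. P))"
    if "f \<in> \<F>" "j \<in> double_index n" for f j
    by (rule measurable_compose[OF measurable_component_singleton[OF that(2)]]) (rule F(2)[OF that(1)])
  have avg: "(\<lambda>z. ?a f b z) \<in> borel_measurable (PiM (double_index n) (\<lambda>_. P))" if "f \<in> \<F>" for f b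
    unfolding avg_def
    by (rule borel_measurable_divide[OF borel_measurable_sum borel_measurable_const], rule coordinate[OF that]) auto
  have ghost: "ennreal (ratio_exp r \<gamma> (?a f True z) (\<integral>x. f x \<partial>P))
      \<le> (\<integral>\<^sup>+z'. ennreal (ratio_exp r \<gamma> (?a f True z) (?a f False z')) \<partial>?NF)"
    if f: "f \<in> \<F>" and z: "z \<in> space ?NT" for f z
  proof -
    have "?a f True z \<in> {0..1}"
      using z F01[OF f] by (intro avg_in_01) (auto simp: space_PiM PiE_def Pi_def)
    then show ?thesis
      by (subst mean, intro ratio_exp_le_nn_integral_avg(2)[OF P _ _ r])
        (use F01[OF f] F(2)[OF f] in simp_all)
  qed
  have "(\<integral>\<^sup>+z. (SUP f\<in>\<F>. ennreal (ratio_exp r \<gamma> (?a f True z) (\<integral>x. f x \<partial>P))) \<partial>?NT)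
      \<le> (\<integral>\<^sup>+z. \<integral>\<^sup>+z'. (SUP f\<in>\<F>. ennreal (ratio_exp r \<gamma> (?a f True z) (?a f False z'))) \<partial>?NF \<partial>?NT)"
    by (intro nn_integral_mono SUP_least order_trans[OF ghost]) (auto intro: SUP_upper)
  also have "\<dots> = (\<integral>\<^sup>+z. (SUP f\<in>\<F>. ennreal (ratio_exp r \<gamma> (?a f True z) (?a f False z)))
      \<partial>PiM (double_index n) (\<lambda>_. P))"
  proof (subst nn_integral_fold_blocks[OF P])
    show "(\<lambda>z. SUP f\<in>\<F>. ennreal (ratio_exp r \<gamma> (?a f True z) (?a f False z))) \<in> borel_measurable (PiM (double_index n) (\<lambda>_. P))"
      by (intro borel_measurable_SUP F(1) measurable_compose[OF _ measurable_ennreal] borel_measurable_ratio_exp avg)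
  qed (simp only: avg_merge[where g = "\<lambda>_ x. f x" for f])
  finally show ?thesis .
qed

lemma nn_integral_sup_empirical_le:
  assumes P: "prob_space P" and F: "countable \<F>" "\<And>f. f \<in> \<F> \<Longrightarrow> f \<in> borel_measurable P"
    and F01: "\<And>f z. f \<in> \<F> \<Longrightarrow> z \<in> space P \<Longrightarrow> f z \<in> {0..1}"
    and r: "\<gamma> > 0" "9 / 8 \<le> \<bar>r\<bar> * sqrt (9 / 10 * \<gamma>)" and n: "n \<ge> 1"
  shows "(\<integral>\<^sup>+z. (SUP f\<in>\<F>. ennreal (ratio_exp r \<gamma> (avg n True (\<lambda>j. f (z j))) (\<integral>x. f x \<partial>P)))
      \<partial>PiM (block n True) (\<lambda>_. P))
    \<le> ennreal (real (shatter_coeff (space P \<times> {0..1}) (subgraphs (space P) \<F>) (2 * n))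
        * exp (r\<^sup>2 / (2 * real n)))"
proof -
  let ?N = "PiM (double_index n) (\<lambda>_. P)" and ?V = "PiM (double_index n) (\<lambda>_. unit_uniform)"
  have rounding: "(SUP f\<in>\<F>. ennreal (ratio_exp r \<gamma> (avg n True (\<lambda>j. f (z j))) (avg n False (\<lambda>j. f (z j)))))
      \<le> (\<integral>\<^sup>+u. sup_ratio_exp r \<gamma> n \<F> z u \<partial>?V)" if z: "z \<in> space ?N" for z
  proof (rule SUP_least)
    fix f assume f: "f \<in> \<F>"
    have "ennreal (ratio_exp r \<gamma> (avg n True (\<lambda>j. f (z j))) (avg n False (\<lambda>j. f (z j))))
        \<le> (\<integral>\<^sup>+u. ennreal (ratio_exp r \<gamma> (avg n True (\<lambda>j. of_bool (u j \<le> f (z j))))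
            (avg n False (\<lambda>j. of_bool (u j \<le> f (z j))))) \<partial>?V)"
      by (rule ratio_exp_le_rounding[OF _ r])
        (use z F01[OF f] in \<open>auto simp: space_PiM PiE_def Pi_def\<close>)
    also have "\<dots> \<le> (\<integral>\<^sup>+u. sup_ratio_exp r \<gamma> n \<F> z u \<partial>?V)"
      unfolding sup_ratio_exp_def below_def[abs_def] by (intro nn_integral_mono SUP_upper f)
    finally show "ennreal (ratio_exp r \<gamma> (avg n True (\<lambda>j. f (z j))) (avg n False (\<lambda>j. f (z j))))
        \<le> (\<integral>\<^sup>+u. sup_ratio_exp r \<gamma> n \<F> z u \<partial>?V)" .
  qed
  have "(\<integral>\<^sup>+z. (SUP f\<in>\<F>. ennreal (ratio_exp r \<gamma> (avg n True (\<lambda>j. f (z j))) (\<integral>x. f x \<partial>P)))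
      \<partial>PiM (block n True) (\<lambda>_. P))
    \<le> (\<integral>\<^sup>+z. (SUP f\<in>\<F>. ennreal (ratio_exp r \<gamma> (avg n True (\<lambda>j. f (z j))) (avg n False (\<lambda>j. f (z j))))) \<partial>?N)"
    by (rule nn_integral_sup_ghost) (use assms in blast)+
  also have "\<dots> \<le> (\<integral>\<^sup>+z. \<integral>\<^sup>+u. sup_ratio_exp r \<gamma> n \<F> z u \<partial>?V \<partial>?N)"
    by (intro nn_integral_mono rounding)
  also have "\<dots> \<le> ennreal (real (shatter_coeff (space P \<times> {0..1}) (subgraphs (space P) \<F>) (2 * n))
        * exp (r\<^sup>2 / (2 * real n)))"
    by (rule nn_integral_sup_ratio_exp_le) (use assms in blast)+
  finally show ?thesis .
qed


section \<open>The relative deviation inequalities\<close>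

text \<open>Markov's inequality at level \<open>exp (r\<^sup>2 / n)\<close>, against an expectation bounded by the
shatter coefficient times \<open>exp (r\<^sup>2 / (2 n))\<close>. Stating it for a subset \<open>A\<close> of the large-deviation event avoids a proof that
the events of interest are measurable.\<close>
lemma prob_sup_ratio_exp_le:
  fixes M :: "'w measure" and P :: "'s measure" and Z :: "nat \<Rightarrow> 'w \<Rightarrow> 's"
  assumes M: "prob_space M" and P: "prob_space P" and n: "n \<ge> 1"
    and indep: "prob_space.indep_vars M (\<lambda>_. P) Z {1..n}"
    and distr: "\<And>i. i \<in> {1..n} \<Longrightarrow> distr M P (Z i) = P"
    and F: "countable \<F>" "\<And>f. f \<in> \<F> \<Longrightarrow> f \<in> borel_measurable P"
    and F01: "\<And>f z. f \<in> \<F> \<Longrightarrow> z \<in> space P \<Longrightarrow> f z \<in> {0..1}"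
    and r: "\<gamma> > 0" "9 / 8 \<le> \<bar>r\<bar> * sqrt (9 / 10 * \<gamma>)"
    and A: "A \<subseteq> {\<omega> \<in> space M. \<exists>f\<in>\<F>. exp (r\<^sup>2 / real n) \<le> ratio_exp r \<gamma> (empirical_mean Z n f \<omega>) (\<integral>x. f x \<partial>P)}"
  shows "measure M A \<le> real (shatter_coeff (space P \<times> {0..1}) (subgraphs (space P) \<F>) (2 * n))
        * exp (- (r\<^sup>2 / (2 * real n)))"
proof -
  interpret M: prob_space M by fact
  let ?S = "real (shatter_coeff (space P \<times> {0..1}) (subgraphs (space P) \<F>) (2 * n))"
  let ?N = "PiM (block n True) (\<lambda>_. P)"
  define \<zeta> where "\<zeta> \<omega> = (\<lambda>j\<in>block n True. Z (fst j) \<omega>)" for \<omega>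
  define H where "H z = (SUP f\<in>\<F>. ennreal (ratio_exp r \<gamma> (avg n True (\<lambda>j. f (z j))) (\<integral>x. f x \<partial>P)))" for z
  have Z: "Z i \<in> M \<rightarrow>\<^sub>M P" if "i \<in> {1..n}" for i
    using indep that by (auto simp: M.indep_vars_def)
  have \<zeta> [measurable]: "\<zeta> \<in> M \<rightarrow>\<^sub>M ?N"
    unfolding \<zeta>_def[abs_def] by (intro measurable_restrict Z) auto
  \<comment> \<open>The sample, re-indexed by the first block, has the product law.\<close>
  have joint: "distr M ?N \<zeta> = ?N"
  proof -
    let ?Q = "PiM {1..n} (\<lambda>_. P)"
    let ?X = "\<lambda>\<omega>. \<lambda>i\<in>{1..n}. Z i \<omega>" and ?R = "\<lambda>z. \<lambda>j\<in>block n True. z (fst j) :: 's"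
    have X: "?X \<in> M \<rightarrow>\<^sub>M ?Q" by (intro measurable_restrict Z)
    have R: "?R \<in> ?Q \<rightarrow>\<^sub>M ?N" by (intro measurable_restrict measurable_component_singleton) auto
    have "distr M ?Q ?X = PiM {1..n} (\<lambda>i. distr M P (Z i))"
      using indep by (subst (asm) M.indep_vars_iff_distr_eq_PiM') (use n Z in auto)
    also have "\<dots> = ?Q" by (intro PiM_cong refl distr)
    finally have X_distr: "distr M ?Q ?X = ?Q" .
    have "\<zeta> = ?R \<circ> ?X" by (intro ext) (auto simp: \<zeta>_def restrict_def)
    then have "distr M ?N \<zeta> = distr (distr M ?Q ?X) ?N ?R"
      by (simp only: distr_distr[OF R X])
    also have "\<dots> = ?N"
      unfolding X_distr by (intro distr_PiM_reindex P) (auto simp: inj_on_def)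
    finally show ?thesis .
  qed
  have coordinate: "(\<lambda>z. f (z j)) \<in> borel_measurable ?N" if "f \<in> \<F>" "j \<in> block n True" for f j
    by (rule measurable_compose[OF measurable_component_singleton[OF that(2)]]) (rule F(2)[OF that(1)])
  have avg: "(\<lambda>z. avg n True (\<lambda>j. f (z j))) \<in> borel_measurable ?N" if "f \<in> \<F>" for f
    unfolding avg_def
    by (rule borel_measurable_divide[OF borel_measurable_sum borel_measurable_const], rule coordinate[OF that]) auto
  have [measurable]: "H \<in> borel_measurable ?N"
    unfolding H_def[abs_def]
    by (intro borel_measurable_SUP F(1) measurable_compose[OF _ measurable_ennreal] borel_measurable_ratio_exp
        avg borel_measurable_const)
  have mean: "avg n True (\<lambda>j. f (\<zeta> \<omega> j)) = empirical_mean Z n f \<omega>" for f \<omega>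
    unfolding avg_def empirical_mean_def \<zeta>_def by (intro arg_cong2[of _ _ _ _ divide] sum.cong) auto
  define B where "B = {\<omega> \<in> space M. 1 \<le> ennreal (exp (- (r\<^sup>2 / real n))) * H (\<zeta> \<omega>)}"
  have "A \<subseteq> B"
  proof
    fix \<omega> assume "\<omega> \<in> A"
    with A obtain f where f: "\<omega> \<in> space M" "f \<in> \<F>"
      "exp (r\<^sup>2 / real n) \<le> ratio_exp r \<gamma> (empirical_mean Z n f \<omega>) (\<integral>x. f x \<partial>P)"
      by blast
    have "1 = ennreal (exp (- (r\<^sup>2 / real n))) * ennreal (exp (r\<^sup>2 / real n))"
      by (simp flip: ennreal_mult exp_add)
    also have "\<dots> \<le> ennreal (exp (- (r\<^sup>2 / real n))) * H (\<zeta> \<omega>)"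
      unfolding H_def mean using f(2,3) by (intro mult_left_mono SUP_upper2[of f] ennreal_leI) auto
    finally show "\<omega> \<in> B" using f(1) by (simp add: B_def)
  qed
  have "emeasure M B \<le> ennreal (exp (- (r\<^sup>2 / real n))) * (\<integral>\<^sup>+\<omega>. H (\<zeta> \<omega>) * indicator (space M) \<omega> \<partial>M)"
    unfolding B_def by (rule nn_integral_Markov_inequality) measurable
  also have "(\<integral>\<^sup>+\<omega>. H (\<zeta> \<omega>) * indicator (space M) \<omega> \<partial>M) = (\<integral>\<^sup>+\<omega>. H (\<zeta> \<omega>) \<partial>M)"
    by (intro nn_integral_cong) simp
  also have "\<dots> = (\<integral>\<^sup>+z. H z \<partial>distr M ?N \<zeta>)"
    by (intro nn_integral_distr[symmetric]) measurable
  also have "\<dots> = (\<integral>\<^sup>+z. H z \<partial>?N)"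
    unfolding joint ..
  also have "\<dots> \<le> ennreal (?S * exp (r\<^sup>2 / (2 * real n)))"
    unfolding H_def by (rule nn_integral_sup_empirical_le) (use assms in blast)+
  also have "ennreal (exp (- (r\<^sup>2 / real n))) * ennreal (?S * exp (r\<^sup>2 / (2 * real n)))
      = ennreal (?S * exp (- (r\<^sup>2 / (2 * real n))))"
  proof -
    have "exp (- (r\<^sup>2 / real n)) * exp (r\<^sup>2 / (2 * real n)) = exp (- (r\<^sup>2 / (2 * real n)))"
      using n by (simp add: field_simps flip: exp_add)
    then show ?thesis by (simp flip: ennreal_mult add: mult.left_commute)
  qed
  finally have "measure M B \<le> ?S * exp (- (r\<^sup>2 / (2 * real n)))"
    by (simp add: M.emeasure_eq_measure mult_left_mono)
  moreover have "measure M A \<le> measure M B"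
    by (rule M.finite_measure_mono[OF \<open>A \<subseteq> B\<close>]) (simp add: B_def)
  ultimately show ?thesis by linarith
qed

text \<open>The hypothesis forces \<open>x - y \<ge> \<gamma>\<close>, so that \<open>x + y + \<gamma> \<le> 2 x\<close> and the denominator
\<open>sqrt x\<close> can be exchanged for the symmetric one.\<close>
lemma ratio_le_of_gap:
  fixes x y \<gamma> t :: real
  assumes "x - y - \<gamma> \<ge> t * sqrt x" "x \<ge> 0" "y \<ge> 0" "\<gamma> > 0" "t > 0"
  shows "t / sqrt 2 \<le> (x - y) / sqrt (x + y + \<gamma>)"
proof -
  have tx: "0 \<le> t * sqrt x" using assms by simp
  have pos: "x + y + \<gamma> > 0" using assms by simp
  have "x + y + \<gamma> \<le> 2 * x" using tx assms by linarith
  then have "t / sqrt 2 * sqrt (x + y + \<gamma>) \<le> t / sqrt 2 * sqrt (2 * x)"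
    using assms by (intro mult_left_mono real_sqrt_le_mono) auto
  also have "\<dots> = t * sqrt x"
    by (simp add: real_sqrt_mult)
  also have "\<dots> \<le> x - y" using assms by linarith
  finally show ?thesis
    using pos by (simp add: pos_le_divide_eq)
qed

text \<open>A negative number divided by \<open>0\<close> is \<open>- \<infinity>\<close>, hence a vanishing denominator never
contributes to the event.\<close>
lemma less_ereal_ratio_sqrtD:
  assumes "ereal t < ereal c / ereal (sqrt x)" "t > 0" "x \<ge> 0" "x = 0 \<Longrightarrow> c < 0"
  shows "t * sqrt x \<le> c"
proof (cases "x = 0")
  case True
  then have "ereal c / ereal (sqrt x) = - \<infinity>"
    using assms(4) ereal_ratio_conventions(2) by simp
  then show ?thesis using assms(1) by simp
next
  case False
  then have "sqrt x > 0" using assms(3) by simp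
  then show ?thesis using assms(1) by (simp add: pos_less_divide_eq)
qed

theorem theorem3:
  fixes M :: "'w measure" and P :: "'s measure"
    and Z :: "nat \<Rightarrow> 'w \<Rightarrow> 's" and n :: nat
    and \<F> :: "('s \<Rightarrow> real) set" and t \<gamma> :: real
  assumes "prob_space M" and "prob_space P"
    and "n \<ge> 1"
    and "prob_space.indep_vars M (\<lambda>_. P) Z {1..n}"
    and "\<And>i. i \<in> {1..n} \<Longrightarrow> distr M P (Z i) = P"
    and "countable \<F>"
    and "\<And>f. f \<in> \<F> \<Longrightarrow> f \<in> borel_measurable P"
    and "\<And>f z. f \<in> \<F> \<Longrightarrow> z \<in> space P \<Longrightarrow> 0 \<le> f z \<and> f z \<le> 1"
    and "t > 0" and "\<gamma> > 0" and "t * real n * sqrt \<gamma> \<ge> 16 / 9"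
  shows "\<P>(\<omega> in M. (SUP f\<in>\<F>. ereal (empirical_mean Z n f \<omega> - (\<integral>z. f z \<partial>P) - \<gamma>)
                            / ereal (sqrt (empirical_mean Z n f \<omega>))) > ereal t)
           \<le> real (shatter_coeff (space P \<times> {0..1}) (subgraphs (space P) \<F>) (2 * n))
              * exp (- (real n * t\<^sup>2 / 4))
       \<and> \<P>(\<omega> in M. (SUP f\<in>\<F>. ereal ((\<integral>z. f z \<partial>P) - empirical_mean Z n f \<omega> - \<gamma>)
                            / ereal (sqrt (\<integral>z. f z \<partial>P))) > ereal t)
           \<le> real (shatter_coeff (space P \<times> {0..1}) (subgraphs (space P) \<F>) (2 * n))
              * exp (- (real n * t\<^sup>2 / 4))"
proof -
  interpret M: prob_space M by fact
  let ?S = "real (shatter_coeff (space P \<times> {0..1}) (subgraphs (space P) \<F>) (2 * n))"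
  define r where "r = real n * t / sqrt 2"
  have F01: "f z \<in> {0..1}" if "f \<in> \<F>" "z \<in> space P" for f z
    using assms(8)[OF that] by simp
  have r2: "r\<^sup>2 / real n = r * (t / sqrt 2)" "r\<^sup>2 / (2 * real n) = real n * t\<^sup>2 / 4"
    using assms(3) by (simp_all add: r_def power2_eq_square field_simps)
  have "r > 0" using assms by (simp add: r_def)
  \<comment> \<open>Squared, this says \<open>81/64 \<le> 9/20 (t n)\<^sup>2 \<gamma>\<close>, and \<open>9/20 (16/9)\<^sup>2 = 64/45\<close>.\<close>
  have r: "9 / 8 \<le> \<bar>r\<bar> * sqrt (9 / 10 * \<gamma>)"
  proof (rule power2_le_imp_le)
    have "(16 / 9)\<^sup>2 \<le> (t * real n * sqrt \<gamma>)\<^sup>2"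
      by (rule power_mono[OF assms(11)]) simp
    also have "\<dots> = t\<^sup>2 * (real n)\<^sup>2 * \<gamma>"
      using assms by (simp add: power_mult_distrib)
    finally have "9 / 20 * (16 / 9)\<^sup>2 \<le> 9 / 20 * (t\<^sup>2 * (real n)\<^sup>2 * \<gamma>)" by simp
    also have "\<dots> = (\<bar>r\<bar> * sqrt (9 / 10 * \<gamma>))\<^sup>2"
      using assms(10) by (simp add: r_def power_mult_distrib power_divide)
    finally show "(9 / 8)\<^sup>2 \<le> (\<bar>r\<bar> * sqrt (9 / 10 * \<gamma>))\<^sup>2"
      by (simp add: power2_eq_square)
    show "0 \<le> \<bar>r\<bar> * sqrt (9 / 10 * \<gamma>)" using assms(10) by simp
  qed
  have Pf: "0 \<le> (\<integral>z. f z \<partial>P)" if "f \<in> \<F>" for f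
    using F01[OF that] by (intro integral_nonneg_AE AE_I2) auto
  have Pn: "0 \<le> empirical_mean Z n f \<omega>" if "f \<in> \<F>" "\<omega> \<in> space M" for f \<omega>
  proof -
    have "Z i \<omega> \<in> space P" if "i \<in> {1..n}" for i
      using assms(4) that \<open>\<omega> \<in> space M\<close> by (auto simp: M.indep_vars_def dest: measurable_space)
    then show ?thesis
      using F01[OF \<open>f \<in> \<F>\<close>] unfolding empirical_mean_def by (intro divide_nonneg_nonneg sum_nonneg) auto
  qed
  have exponent: "exp (r\<^sup>2 / real n) \<le> ratio_exp r \<gamma> x y"
    if "t * sqrt x \<le> x - y - \<gamma>" "0 \<le> x" "0 \<le> y" for x y
    using ratio_le_of_gap[of t x y \<gamma>] that assms(9,10) \<open>r > 0\<close>
    by (simp add: ratio_exp_def r2 flip: times_divide_eq_right)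
  have bound: "measure M A \<le> ?S * exp (- (\<rho>\<^sup>2 / (2 * real n)))"
    if "9 / 8 \<le> \<bar>\<rho>\<bar> * sqrt (9 / 10 * \<gamma>)"
      and "A \<subseteq> {\<omega> \<in> space M. \<exists>f\<in>\<F>. exp (\<rho>\<^sup>2 / real n) \<le> ratio_exp \<rho> \<gamma> (empirical_mean Z n f \<omega>) (\<integral>x. f x \<partial>P)}"
    for \<rho> A
    by (rule prob_sup_ratio_exp_le[where Z = Z and \<gamma> = \<gamma>]) (use assms(1-7,10) F01 that in blast)+
  have "measure M {\<omega> \<in> space M. ereal t < (SUP f\<in>\<F>. ereal (empirical_mean Z n f \<omega> - (\<integral>z. f z \<partial>P) - \<gamma>)
      / ereal (sqrt (empirical_mean Z n f \<omega>)))} \<le> ?S * exp (- (r\<^sup>2 / (2 * real n)))"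
  proof (rule bound[OF r], safe)
    fix \<omega> assume \<omega>: "\<omega> \<in> space M"
      and "ereal t < (SUP f\<in>\<F>. ereal (empirical_mean Z n f \<omega> - (\<integral>z. f z \<partial>P) - \<gamma>)
      / ereal (sqrt (empirical_mean Z n f \<omega>)))"
    then obtain f where f: "f \<in> \<F>" "ereal t < ereal (empirical_mean Z n f \<omega> - (\<integral>z. f z \<partial>P) - \<gamma>)
      / ereal (sqrt (empirical_mean Z n f \<omega>))"
      unfolding less_SUP_iff by blast
    have "t * sqrt (empirical_mean Z n f \<omega>) \<le> empirical_mean Z n f \<omega> - (\<integral>z. f z \<partial>P) - \<gamma>"
      using Pf[OF f(1)] Pn[OF f(1) \<omega>] assms(9,10) by (intro less_ereal_ratio_sqrtD[OF f(2)]) auto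
    then show "\<exists>f\<in>\<F>. exp (r\<^sup>2 / real n) \<le> ratio_exp r \<gamma> (empirical_mean Z n f \<omega>) (\<integral>x. f x \<partial>P)"
      using f(1) exponent Pf Pn \<omega> by blast
  qed
  moreover have "measure M {\<omega> \<in> space M. ereal t < (SUP f\<in>\<F>. ereal ((\<integral>z. f z \<partial>P) - empirical_mean Z n f \<omega> - \<gamma>)
      / ereal (sqrt (\<integral>z. f z \<partial>P)))} \<le> ?S * exp (- ((- r)\<^sup>2 / (2 * real n)))"
  proof (rule bound, use r in simp, safe)
    fix \<omega> assume \<omega>: "\<omega> \<in> space M"
      and "ereal t < (SUP f\<in>\<F>. ereal ((\<integral>z. f z \<partial>P) - empirical_mean Z n f \<omega> - \<gamma>)
      / ereal (sqrt (\<integral>z. f z \<partial>P)))"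
    then obtain f where f: "f \<in> \<F>" "ereal t < ereal ((\<integral>z. f z \<partial>P) - empirical_mean Z n f \<omega> - \<gamma>)
      / ereal (sqrt (\<integral>z. f z \<partial>P))"
      unfolding less_SUP_iff by blast
    have "t * sqrt (\<integral>z. f z \<partial>P) \<le> (\<integral>z. f z \<partial>P) - empirical_mean Z n f \<omega> - \<gamma>"
      using Pf[OF f(1)] Pn[OF f(1) \<omega>] assms(9,10) by (intro less_ereal_ratio_sqrtD[OF f(2)]) auto
    then have "exp (r\<^sup>2 / real n) \<le> ratio_exp r \<gamma> (\<integral>x. f x \<partial>P) (empirical_mean Z n f \<omega>)"
      using f(1) exponent Pf Pn \<omega> by blast
    then have "exp ((- r)\<^sup>2 / real n) \<le> ratio_exp (- r) \<gamma> (empirical_mean Z n f \<omega>) (\<integral>x. f x \<partial>P)"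
      by (simp add: ratio_exp_commute[of r])
    then show "\<exists>f\<in>\<F>. exp ((- r)\<^sup>2 / real n) \<le> ratio_exp (- r) \<gamma> (empirical_mean Z n f \<omega>) (\<integral>x. f x \<partial>P)"
      using f(1) by blast
  qed
  ultimately show ?thesis
    by (simp add: r2)
qed

end
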